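(* Let $\Omega_1,\Omega_2$ be two domains in $\mathbb{C}$ and let $T:\mathcal{H}ol(\Omega_1)\to\mathcal{H}ol(\Omega_2)$ be a linear operator such that for every $z\in\Omega_2$ the function $\mathcal{H}ol(\Omega_1)\ni f\mapsto T(f)(z)\in\mathbb{C}$ is continuous. Let $\mathcal{U}_T=\{f\in\mathcal{H}ol(\Omega_1): T(f)\text{ is unbounded on }\Omega_2\}$. Then either $\mathcal{U}_T=\emptyset$ or $\mathcal{U}_T$ is a dense $G_\delta$ set in $\mathcal{H}ol(\Omega_1)$.
   Context: A domain is an open connected subset of $\mathbb{C}$. For an open set $\Omega\subset\mathbb{C}$, $\mathcal{H}ol(\Omega)$ is the space of all holomorphic functions on $\Omega$ with the topology of uniform convergence on compact subsets of $\Omega$. A $G_\delta$ set is a countable intersection of open sets; a dense $G_\delta$ set is a $G_\delta$ set that is also dense. *)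

theory Defs
  imports "HOL-Complex_Analysis.Complex_Analysis"
begin

text \<open>
  The space of holomorphic functions on \<open>\<Omega>\<close>. HOL functions are total, so a holomorphic function on
  \<open>\<Omega>\<close> is represented by its unique extension vanishing outside \<open>\<Omega>\<close>; these
  extensions form a complex vector space under pointwise operations.
\<close>

definition Hol :: "complex set \<Rightarrow> (complex \<Rightarrow> complex) set" where
  "Hol \<Omega> = {f. f holomorphic_on \<Omega> \<and> (\<forall>z. z \<notin> \<Omega> \<longrightarrow> f z = 0)}"

definition Hol_nbhd ::
    "complex set \<Rightarrow> complex set \<Rightarrow> real \<Rightarrow> (complex \<Rightarrow> complex) \<Rightarrow> (complex \<Rightarrow> complex) set" where
  "Hol_nbhd \<Omega> K e f = {g \<in> Hol \<Omega>. \<forall>z\<in>K. dist (g z) (f z) < e}"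

definition Hol_top :: "complex set \<Rightarrow> (complex \<Rightarrow> complex) topology" where
  "Hol_top \<Omega> = topology (\<lambda>U. U \<subseteq> Hol \<Omega> \<and>
     (\<forall>f\<in>U. \<exists>K e. compact K \<and> K \<subseteq> \<Omega> \<and> e > 0 \<and> Hol_nbhd \<Omega> K e f \<subseteq> U))"

lemma openin_Hol_top:
  "openin (Hol_top \<Omega>) U \<longleftrightarrow> U \<subseteq> Hol \<Omega> \<and>
     (\<forall>f\<in>U. \<exists>K e. compact K \<and> K \<subseteq> \<Omega> \<and> e > 0 \<and> Hol_nbhd \<Omega> K e f \<subseteq> U)"
proof -
  define Q where "Q U f \<longleftrightarrow>
    (\<exists>K e. compact K \<and> K \<subseteq> \<Omega> \<and> e > 0 \<and> Hol_nbhd \<Omega> K e f \<subseteq> U)" for U f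
  have Q_mono: "Q T f" if "Q S f" "S \<subseteq> T" for S T f
    using that unfolding Q_def by (meson order_trans)
  have Q_Int: "Q (S \<inter> T) f" if S: "Q S f" and T: "Q T f" for S T f
  proof -
    from S obtain K d where K: "compact K" "K \<subseteq> \<Omega>" "d > 0" "Hol_nbhd \<Omega> K d f \<subseteq> S"
      unfolding Q_def by (elim exE conjE)
    from T obtain L e where L: "compact L" "L \<subseteq> \<Omega>" "e > 0" "Hol_nbhd \<Omega> L e f \<subseteq> T"
      unfolding Q_def by (elim exE conjE)
    have "Hol_nbhd \<Omega> (K \<union> L) (min d e) f \<subseteq> Hol_nbhd \<Omega> K d f \<inter> Hol_nbhd \<Omega> L e f"
      by (auto simp: Hol_nbhd_def)
    also have "\<dots> \<subseteq> S \<inter> T" using K(4) L(4) by (rule Int_mono)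
    finally show ?thesis
      unfolding Q_def using K(1-3) L(1-3)
      by (intro exI[of _ "K \<union> L"] exI[of _ "min d e"] conjI) (simp_all add: compact_Un)
  qed
  have "istopology (\<lambda>U. U \<subseteq> Hol \<Omega> \<and> (\<forall>f\<in>U. Q U f))"
    unfolding istopology_def
  proof (intro conjI allI impI)
    fix S T assume "S \<subseteq> Hol \<Omega> \<and> (\<forall>f\<in>S. Q S f)" "T \<subseteq> Hol \<Omega> \<and> (\<forall>f\<in>T. Q T f)"
    then show "S \<inter> T \<subseteq> Hol \<Omega>" "\<forall>f\<in>S \<inter> T. Q (S \<inter> T) f"
      by (blast, simp add: Q_Int)
  next
    fix \<K> assume A: "\<forall>S\<in>\<K>. S \<subseteq> Hol \<Omega> \<and> (\<forall>f\<in>S. Q S f)"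
    then show "\<Union>\<K> \<subseteq> Hol \<Omega>" by blast
    show "\<forall>f\<in>\<Union>\<K>. Q (\<Union>\<K>) f"
      using A by (meson Q_mono UnionE Union_upper)
  qed
  then show ?thesis
    unfolding Hol_top_def Q_def by (simp only: topology_inverse')
qed

lemma topspace_Hol_top [simp]: "topspace (Hol_top \<Omega>) = Hol \<Omega>"
proof
  show "topspace (Hol_top \<Omega>) \<subseteq> Hol \<Omega>"
    using openin_Hol_top openin_topspace by blast
  have "\<exists>K e. compact K \<and> K \<subseteq> \<Omega> \<and> e > 0 \<and> Hol_nbhd \<Omega> K e f \<subseteq> Hol \<Omega>" for f
    by (intro exI[of _ "{}"] exI[of _ "1::real"]) (simp add: Hol_nbhd_def)
  then have "openin (Hol_top \<Omega>) (Hol \<Omega>)"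
    unfolding openin_Hol_top by simp
  then show "Hol \<Omega> \<subseteq> topspace (Hol_top \<Omega>)"
    by (rule openin_subset)
qed

lemma limitin_Hol_top:
  assumes h: "\<And>i. h i \<in> Hol \<Omega>"
  shows "limitin (Hol_top \<Omega>) h f F \<longleftrightarrow>
    f \<in> Hol \<Omega> \<and> (\<forall>K. compact K \<and> K \<subseteq> \<Omega> \<longrightarrow> uniform_limit K h f F)"
proof (intro iffI conjI allI impI)
  assume L: "limitin (Hol_top \<Omega>) h f F"
  then show f: "f \<in> Hol \<Omega>" by (simp add: limitin_def)
  fix K assume K: "compact K \<and> K \<subseteq> \<Omega>"
  show "uniform_limit K h f F"
  proof (rule uniform_limitI)
    fix e :: real assume e: "e > 0"
    define U where "U = {g \<in> Hol \<Omega>. \<exists>r<e. \<forall>z\<in>K. dist (g z) (f z) \<le> r}"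
    have "openin (Hol_top \<Omega>) U"
      unfolding openin_Hol_top
    proof (intro conjI ballI)
      show "U \<subseteq> Hol \<Omega>" unfolding U_def by (rule Collect_restrict)
      fix g assume "g \<in> U"
      then obtain r where r: "r < e" "\<forall>z\<in>K. dist (g z) (f z) \<le> r"
        unfolding U_def by blast
      have "Hol_nbhd \<Omega> K ((e - r) / 2) g \<subseteq> U"
      proof
        fix k assume k: "k \<in> Hol_nbhd \<Omega> K ((e - r) / 2) g"
        have "dist (k z) (f z) \<le> (r + e) / 2" if "z \<in> K" for z
        proof -
          have "dist (k z) (g z) < (e - r) / 2" "dist (g z) (f z) \<le> r"
            using k r(2) that by (simp_all add: Hol_nbhd_def)
          then show ?thesis
            using dist_triangle[of "k z" "f z" "g z"] by (simp add: field_simps)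
        qed
        moreover have "(r + e) / 2 < e" using r(1) by simp
        moreover have "k \<in> Hol \<Omega>" using k by (simp add: Hol_nbhd_def)
        ultimately show "k \<in> U" unfolding U_def by blast
      qed
      then show "\<exists>K e. compact K \<and> K \<subseteq> \<Omega> \<and> e > 0 \<and> Hol_nbhd \<Omega> K e g \<subseteq> U"
        using K r(1) by (intro exI[of _ K] exI[of _ "(e - r) / 2"] conjI) simp_all
    qed
    moreover have "f \<in> U"
      unfolding U_def using f e by force
    ultimately have "\<forall>\<^sub>F i in F. h i \<in> U" using L by (simp add: limitin_def)
    then show "\<forall>\<^sub>F i in F. \<forall>z\<in>K. dist (h i z) (f z) < e"
      by (rule eventually_mono) (unfold U_def, fastforce)
  qed
next
  assume R: "f \<in> Hol \<Omega> \<and> (\<forall>K. compact K \<and> K \<subseteq> \<Omega> \<longrightarrow> uniform_limit K h f F)"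
  show "limitin (Hol_top \<Omega>) h f F"
    unfolding limitin_def
  proof (intro conjI allI impI)
    show "f \<in> topspace (Hol_top \<Omega>)" using R by simp
    fix U assume "openin (Hol_top \<Omega>) U \<and> f \<in> U"
    then have "\<exists>K e. compact K \<and> K \<subseteq> \<Omega> \<and> e > 0 \<and> Hol_nbhd \<Omega> K e f \<subseteq> U"
      by (simp add: openin_Hol_top)
    then obtain K e where K: "compact K" "K \<subseteq> \<Omega>" "e > 0" "Hol_nbhd \<Omega> K e f \<subseteq> U"
      by (elim exE conjE)
    then have "uniform_limit K h f F" using R by simp
    from uniform_limitD[OF this K(3)]
    have "\<forall>\<^sub>F i in F. h i \<in> Hol_nbhd \<Omega> K e f"
      by (rule eventually_mono) (simp add: Hol_nbhd_def h)
    then show "\<forall>\<^sub>F i in F. h i \<in> U"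
      by (rule eventually_mono) (use K(4) in blast)
  qed
qed

definition Hol_linear ::
    "complex set \<Rightarrow> complex set \<Rightarrow> ((complex \<Rightarrow> complex) \<Rightarrow> (complex \<Rightarrow> complex)) \<Rightarrow> bool" where
  "Hol_linear \<Omega>1 \<Omega>2 T \<longleftrightarrow>
     T \<in> Hol \<Omega>1 \<rightarrow> Hol \<Omega>2 \<and>
     (\<forall>f\<in>Hol \<Omega>1. \<forall>g\<in>Hol \<Omega>1. T (\<lambda>z. f z + g z) = (\<lambda>z. T f z + T g z)) \<and>
     (\<forall>c. \<forall>f\<in>Hol \<Omega>1. T (\<lambda>z. c * f z) = (\<lambda>z. c * T f z))"

definition unbounded_set ::
    "complex set \<Rightarrow> complex set \<Rightarrow> ((complex \<Rightarrow> complex) \<Rightarrow> (complex \<Rightarrow> complex)) \<Rightarrow>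
     (complex \<Rightarrow> complex) set" where
  "unbounded_set \<Omega>1 \<Omega>2 T = {f \<in> Hol \<Omega>1. \<not> bounded (T f ` \<Omega>2)}"

end

theory Submission
  imports Defs
begin

text \<open>
  The set of unbounded images is the intersection over \<open>n\<close> of the open sets
  \<open>{f. \<exists>z\<in>\<Omega>2. norm (T f z) > n}\<close>. It is dense as soon as it contains some \<open>g\<close>: a
  function \<open>f\<close> outside it is the limit of \<open>f + \<epsilon> g\<close>, which lies in it by linearity, so that
  Baire's theorem is not needed.
\<close>

lemma Hol_add: "f \<in> Hol \<Omega> \<Longrightarrow> g \<in> Hol \<Omega> \<Longrightarrow> (\<lambda>z. f z + g z) \<in> Hol \<Omega>"
  by (auto simp: Hol_def intro!: holomorphic_intros)

lemma Hol_cmult: "f \<in> Hol \<Omega> \<Longrightarrow> (\<lambda>z. c * f z) \<in> Hol \<Omega>"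
  by (auto simp: Hol_def intro!: holomorphic_intros)

text \<open>If the image of the sum were bounded, subtracting the bounded \<open>T f\<close> and
  dividing by \<open>c\<close> would bound \<open>T g\<close>. This supplies the perturbations of
  \<open>f\<close> used for density.\<close>

lemma unbounded_set_add_cmult:
  assumes T: "Hol_linear \<Omega>1 \<Omega>2 T"
    and f: "f \<in> Hol \<Omega>1" "f \<notin> unbounded_set \<Omega>1 \<Omega>2 T"
    and g: "g \<in> unbounded_set \<Omega>1 \<Omega>2 T" and c: "c \<noteq> 0"
  shows "(\<lambda>z. f z + c * g z) \<in> unbounded_set \<Omega>1 \<Omega>2 T"
proof -
  have gH: "g \<in> Hol \<Omega>1" and gU: "\<not> bounded (T g ` \<Omega>2)"
    using g by (auto simp: unbounded_set_def)
  have fB: "bounded (T f ` \<Omega>2)"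
    using f by (auto simp: unbounded_set_def)
  have cg: "(\<lambda>z. c * g z) \<in> Hol \<Omega>1"
    using gH by (rule Hol_cmult)
  have Th: "T (\<lambda>z. f z + c * g z) = (\<lambda>z. T f z + c * T g z)"
    using T f(1) gH cg by (simp add: Hol_linear_def)
  have "\<not> bounded ((\<lambda>z. T f z + c * T g z) ` \<Omega>2)"
  proof
    assume "bounded ((\<lambda>z. T f z + c * T g z) ` \<Omega>2)"
    then have "bounded ((\<lambda>z. (T f z + c * T g z) - T f z) ` \<Omega>2)"
      using fB by (rule bounded_minus_comp)
    \<comment> \<open>The difference equals \<open>c * T g z\<close>, so scaling by
      \<open>1 / c\<close> recovers \<open>T g\<close> exactly, as \<open>c\<close> is
      nonzero.\<close>
    then have "bounded ((*) (1 / c) ` (\<lambda>z. (T f z + c * T g z) - T f z) ` \<Omega>2)"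
      by (rule bounded_linear_image[OF _ bounded_linear_mult_right])
    then show False
      using gU c by (simp add: image_image)
  qed
  then show ?thesis
    using Hol_add[OF f(1) cg] by (simp add: unbounded_set_def Th)
qed

text \<open>Continuity at each single point \<open>z\<close> is enough: exceeding the bound
  \<open>n\<close> somewhere on \<open>\<Omega>2\<close> is witnessed by one point, so
  \<open>V n\<close> is a union of open preimages.\<close>

lemma gdelta_in_unbounded_set:
  assumes cont: "\<And>z. z \<in> \<Omega>2 \<Longrightarrow> continuous_map (Hol_top \<Omega>1) euclidean (\<lambda>f. T f z)"
  shows "gdelta_in (Hol_top \<Omega>1) (unbounded_set \<Omega>1 \<Omega>2 T)"
proof -
  define V where "V n = (\<Union>z\<in>\<Omega>2. {f \<in> Hol \<Omega>1. real n < norm (T f z)})" for n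
  have "openin (Hol_top \<Omega>1) {f \<in> Hol \<Omega>1. real n < norm (T f z)}" if "z \<in> \<Omega>2" for n z
  proof -
    have "open {w::complex. real n < norm w}"
      by (intro open_Collect_less continuous_intros)
    then show ?thesis
      using openin_continuous_map_preimage[OF cont[OF that]] by fastforce
  qed
  then have "openin (Hol_top \<Omega>1) (V n)" for n
    unfolding V_def by blast
  then have "gdelta_in (Hol_top \<Omega>1) (\<Inter>n. V n)"
    by (intro gdelta_in_Inter) (auto intro: open_imp_gdelta_in)
  moreover have "unbounded_set \<Omega>1 \<Omega>2 T = (\<Inter>n. V n)"
  proof -
    \<comment> \<open>Restricting to natural bounds, by the Archimedean property, is what makes the
      intersection countable.\<close>
    have "bounded (T f ` \<Omega>2) \<longleftrightarrow> (\<exists>n. \<forall>z\<in>\<Omega>2. norm (T f z) \<le> real n)" for f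
    proof
      assume "bounded (T f ` \<Omega>2)"
      then obtain B where B: "\<And>z. z \<in> \<Omega>2 \<Longrightarrow> norm (T f z) \<le> B"
        unfolding bounded_iff by blast
      obtain n where "B \<le> real n"
        using real_arch_simple by blast
      with B show "\<exists>n. \<forall>z\<in>\<Omega>2. norm (T f z) \<le> real n"
        by (meson order_trans)
    qed (auto simp: bounded_iff)
    then show ?thesis
      by (auto simp: unbounded_set_def V_def not_le)
  qed
  ultimately show ?thesis
    by simp
qed

lemma unbounded_set_dense:
  assumes T: "Hol_linear \<Omega>1 \<Omega>2 T" and g: "g \<in> unbounded_set \<Omega>1 \<Omega>2 T"
  shows "Hol_top \<Omega>1 closure_of unbounded_set \<Omega>1 \<Omega>2 T = Hol \<Omega>1"
proof -
  have gH: "g \<in> Hol \<Omega>1"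
    using g by (simp add: unbounded_set_def)
  \<comment> \<open>If \<open>f\<close> already has an unbounded image, \<open>f\<close> itself is
    the witness; only the other case calls for a perturbation.\<close>
  have "\<exists>h\<in>unbounded_set \<Omega>1 \<Omega>2 T. h \<in> W" if W: "openin (Hol_top \<Omega>1) W" and f: "f \<in> W" for f W
  proof (cases "f \<in> unbounded_set \<Omega>1 \<Omega>2 T")
    case False
    obtain K e where K: "compact K" "K \<subseteq> \<Omega>1" "e > 0" "Hol_nbhd \<Omega>1 K e f \<subseteq> W"
      using W f unfolding openin_Hol_top by blast
    have fH: "f \<in> Hol \<Omega>1"
      using W f unfolding openin_Hol_top by blast
    \<comment> \<open>The function \<open>g\<close> may be unbounded on \<open>\<Omega>1\<close>,
      but closeness to \<open>f\<close> is only tested on the compact set \<open>K\<close>, where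
      \<open>g\<close> is bounded.\<close>
    have "continuous_on K g"
      using gH K(2) by (auto simp: Hol_def intro: holomorphic_on_imp_continuous_on continuous_on_subset)
    then have "bounded (g ` K)"
      using K(1) by (intro compact_imp_bounded compact_continuous_image)
    then obtain B where B: "B > 0" "\<And>z. z \<in> K \<Longrightarrow> norm (g z) \<le> B"
      unfolding bounded_pos by auto
    \<comment> \<open>The factor 2 leaves room for a strict inequality: on \<open>K\<close> the
      perturbation \<open>c * g z\<close> has norm at most \<open>e / 2\<close>. Taking
      \<open>B\<close> positive keeps \<open>c\<close> well defined and nonzero even if
      \<open>g\<close> vanishes on \<open>K\<close>.\<close>
    define c where "c = complex_of_real (e / (2 * B))"
    have c: "c \<noteq> 0" "norm c = e / (2 * B)"
      using K(3) B(1) by (auto simp: c_def norm_divide norm_mult)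
    have "norm (c * g z) < e" if "z \<in> K" for z
    proof -
      have "norm (c * g z) \<le> e / (2 * B) * B"
        unfolding norm_mult c(2) using B(2)[OF that] B(1) K(3) by (intro mult_left_mono) auto
      also have "\<dots> < e"
        using B(1) K(3) by simp
      finally show ?thesis .
    qed
    then have "(\<lambda>z. f z + c * g z) \<in> Hol_nbhd \<Omega>1 K e f"
      using Hol_add[OF fH Hol_cmult[OF gH]] by (simp add: Hol_nbhd_def dist_norm)
    then show ?thesis
      using unbounded_set_add_cmult[OF T fH False g c(1)] K(4) by blast
  qed (use f in blast)
  then show ?thesis
    unfolding closure_of_def topspace_Hol_top by blast
qed

theorem proposition2p1:
  fixes \<Omega>1 \<Omega>2 :: "complex set"
    and T :: "(complex \<Rightarrow> complex) \<Rightarrow> (complex \<Rightarrow> complex)"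
  assumes "open \<Omega>1" and "connected \<Omega>1"
    and "open \<Omega>2" and "connected \<Omega>2"
    and "Hol_linear \<Omega>1 \<Omega>2 T"
    and "\<And>z. z \<in> \<Omega>2 \<Longrightarrow> continuous_map (Hol_top \<Omega>1) euclidean (\<lambda>f. T f z)"
  shows "unbounded_set \<Omega>1 \<Omega>2 T = {} \<or>
    (gdelta_in (Hol_top \<Omega>1) (unbounded_set \<Omega>1 \<Omega>2 T) \<and>
     Hol_top \<Omega>1 closure_of unbounded_set \<Omega>1 \<Omega>2 T = Hol \<Omega>1)"
proof (cases "unbounded_set \<Omega>1 \<Omega>2 T = {}")
  case False
  then obtain g where "g \<in> unbounded_set \<Omega>1 \<Omega>2 T"
    by fast
  with assms(5) have "Hol_top \<Omega>1 closure_of unbounded_set \<Omega>1 \<Omega>2 T = Hol \<Omega>1"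
    by (rule unbounded_set_dense)
  moreover have "gdelta_in (Hol_top \<Omega>1) (unbounded_set \<Omega>1 \<Omega>2 T)"
    using assms(6) by (rule gdelta_in_unbounded_set)
  ultimately show ?thesis
    by simp
qed simp

end
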